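(* Let $\mathcal{S}$ be a $C^2$-smooth surface of revolution. Suppose $p\in\mathcal{S}$ is an umbilic point, with Gauss angle $\theta_0$, which lies off the axis of symmetry of $\mathcal{S}$, and that $\mathcal{S}$ is non-flat at $p$. In addition assume that there is a punctured neighbourhood $U$ of $\theta_0$ such that $r_2(\theta)\neq r_1(\theta)$ for all $\theta\in U$. Then the function $\mu(\theta)=\frac{r_2(\theta)-r_0}{r_1(\theta)-r_0}$ is unbounded on $U$.
   Context: $\mathcal{S}\subset\mathbb{R}^3$ is a $C^2$-smooth regular oriented surface of revolution about the $z$-axis, fully revolved about it. $k_1$ and $k_2$ denote the principal curvatures along the parallels and along the profile curves respectively, $r_i=1/k_i$ are the radii of curvature, and $K=k_1k_2$ is the Gauss curvature. $\mathcal{S}$ is non-flat at $q$ if $K(q)\ne0$. The Gauss angle $\theta$ is the angle between the oriented unit normal and the positive $z$-axis; near a point with $K\neq 0$ the profile curve $(\rho(\theta),h(\theta))$ in the $yz$-plane ($\rho$ the signed distance from the axis, $h$ the height), with unit normal $(\sin\theta,\cos\theta)$, is parametrised by $\theta$, and $r_1,r_2$ are regarded as functions of $\theta$ on the corresponding interval, with $\rho=r_1\sin\theta$, $dh/d\theta=-r_2\sin\theta$. $U$ is a punctured neighbourhood of $\theta_0$ in this interval. Since $p$ lies off the axis, $\theta_0\ne0,\pi$; by symmetry Gauss angles may be taken in $[0,\pi]$, so $\theta_0\in(0,\pi)$. An umbilic point is a point with $r_1=r_2$, and $r_0$ is the common value $r_1(\theta_0)=r_2(\theta_0)$. The quotient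 $\mu(\theta)$ is considered at those $\theta$ for which $r_1(\theta)\neq r_0$. *)

theory Defs
  imports "HOL-Analysis.Analysis"
begin

definition C2_on :: "('a::euclidean_space \<Rightarrow> 'b::euclidean_space) \<Rightarrow> 'a set \<Rightarrow> bool" where
  "C2_on f W \<longleftrightarrow> open W \<and>
     (\<exists>(f' :: 'a \<Rightarrow> 'a \<Rightarrow>\<^sub>L 'b) (f'' :: 'a \<Rightarrow> 'a \<Rightarrow>\<^sub>L 'a \<Rightarrow>\<^sub>L 'b).
        (\<forall>x\<in>W. (f has_derivative blinfun_apply (f' x)) (at x) \<and>
               (f' has_derivative blinfun_apply (f'' x)) (at x)) \<and>
        continuous_on W f'')"

definition regular_C2_surface :: "(real^3) set \<Rightarrow> bool" where
  "regular_C2_surface S \<longleftrightarrow>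
     (\<forall>q\<in>S. \<exists>(V :: (real^3) set) (W :: (real^2) set) X Y.
        open V \<and> q \<in> V \<and> C2_on X W \<and>
        (\<forall>u\<in>W. inj (frechet_derivative X (at u))) \<and>
        homeomorphism W (S \<inter> V) X Y)"

definition tangent_space :: "(real^3) set \<Rightarrow> real^3 \<Rightarrow> (real^3) set" where
  "tangent_space S q =
     {v. \<exists>c \<epsilon>. \<epsilon> > 0 \<and> c 0 = q \<and> (\<forall>t\<in>{-\<epsilon><..<\<epsilon>}. c t \<in> S) \<and>
              (c has_vector_derivative v) (at 0)}"

definition unit_normal_field :: "(real^3) set \<Rightarrow> (real^3 \<Rightarrow> real^3) \<Rightarrow> bool" where
  "unit_normal_field S N \<longleftrightarrow> continuous_on S N \<and>
     (\<forall>q\<in>S. norm (N q) = 1 \<and> (\<forall>v\<in>tangent_space S q. N q \<bullet> v = 0))"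

definition rot_z :: "real \<Rightarrow> real^3 \<Rightarrow> real^3" where
  "rot_z \<phi> q = vector [cos \<phi> * q$1 - sin \<phi> * q$2, sin \<phi> * q$1 + cos \<phi> * q$2, q$3]"

text \<open>Compatibility of the orientation with the rotations need not be required:
  it follows from the continuity of \<open>N\<close> along the parallels.\<close>
definition oriented_C2_surface_of_revolution ::
    "(real^3) set \<Rightarrow> (real^3 \<Rightarrow> real^3) \<Rightarrow> bool" where
  "oriented_C2_surface_of_revolution S N \<longleftrightarrow>
     regular_C2_surface S \<and> unit_normal_field S N \<and> (\<forall>\<phi>. rot_z \<phi> ` S = S)"

definition z_axis :: "(real^3) set" where
  "z_axis = {q. q$1 = 0 \<and> q$2 = 0}"

text \<open>The eigenvalue of the differential of the Gauss map for a principal direction \<open>v\<close>.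
  The derivative within \<open>S\<close> is determined only on the tangent space of \<open>S\<close>, so \<open>v\<close> has to be
  tangent.  The sign is such that a sphere with outward normal has positive curvatures,
  as the relation \<open>\<rho> = r\<^sub>1 sin \<theta>\<close> requires.\<close>
definition principal_curvature_along ::
    "(real^3) set \<Rightarrow> (real^3 \<Rightarrow> real^3) \<Rightarrow> real^3 \<Rightarrow> real^3 \<Rightarrow> real" where
  "principal_curvature_along S N q v =
     (THE k. \<exists>A. (N has_derivative A) (at q within S) \<and> A v = k *\<^sub>R v)"

definition parallel_dir :: "real^3 \<Rightarrow> real^3" where
  "parallel_dir q = vector [- (q$2), q$1, 0]"

text \<open>The tangent direction orthogonal to the parallel, that is, the direction of the profile
  curve. Both directions vanish on the axis, so the two curvatures below are
  meaningful only at points off the axis.\<close>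
definition profile_dir :: "(real^3 \<Rightarrow> real^3) \<Rightarrow> real^3 \<Rightarrow> real^3" where
  "profile_dir N q = cross3 (parallel_dir q) (N q)"

definition k1 :: "(real^3) set \<Rightarrow> (real^3 \<Rightarrow> real^3) \<Rightarrow> real^3 \<Rightarrow> real" where
  "k1 S N q = principal_curvature_along S N q (parallel_dir q)"

definition k2 :: "(real^3) set \<Rightarrow> (real^3 \<Rightarrow> real^3) \<Rightarrow> real^3 \<Rightarrow> real" where
  "k2 S N q = principal_curvature_along S N q (profile_dir N q)"

definition gauss_curvature :: "(real^3) set \<Rightarrow> (real^3 \<Rightarrow> real^3) \<Rightarrow> real^3 \<Rightarrow> real" where
  "gauss_curvature S N q = k1 S N q * k2 S N q"

definition radius1 :: "(real^3) set \<Rightarrow> (real^3 \<Rightarrow> real^3) \<Rightarrow> real^3 \<Rightarrow> real" where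
  "radius1 S N q = 1 / k1 S N q"

definition radius2 :: "(real^3) set \<Rightarrow> (real^3 \<Rightarrow> real^3) \<Rightarrow> real^3 \<Rightarrow> real" where
  "radius2 S N q = 1 / k2 S N q"

definition umbilic :: "(real^3) set \<Rightarrow> (real^3 \<Rightarrow> real^3) \<Rightarrow> real^3 \<Rightarrow> bool" where
  "umbilic S N q \<longleftrightarrow> radius1 S N q = radius2 S N q"

definition gauss_angle :: "(real^3 \<Rightarrow> real^3) \<Rightarrow> real^3 \<Rightarrow> real" where
  "gauss_angle N q = arccos (N q \<bullet> axis 3 1)"

definition yz_point :: "real \<Rightarrow> real \<Rightarrow> real^3" where
  "yz_point y z = vector [0, y, z]"

text \<open>\<open>\<theta> \<mapsto> (\<rho> \<theta>, h \<theta>)\<close> parametrises the profile curve in the \<open>yz\<close>-plane by the Gauss angle,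
  on an open interval \<open>I\<close> around the Gauss angle of \<open>p\<close>, at which it meets the parallel
  through \<open>p\<close>.  Since \<open>sin \<theta> > 0\<close> on \<open>I\<close>, the normal condition selects one of the two points in
  which a parallel meets the \<open>yz\<close>-plane; \<open>\<rho>\<close> is negative where the normal points
  towards the axis. Differentiability of \<open>\<rho>\<close> and \<open>h\<close>, with \<open>\<rho> = r\<^sub>1 sin \<theta>\<close> and
  \<open>dh/d\<theta> = - r\<^sub>2 sin \<theta>\<close>, is a consequence.\<close>
definition gauss_angle_profile ::
    "(real^3) set \<Rightarrow> (real^3 \<Rightarrow> real^3) \<Rightarrow> real^3 \<Rightarrow> real set \<Rightarrow> (real \<Rightarrow> real) \<Rightarrow> (real \<Rightarrow> real) \<Rightarrow> bool"
  where
  "gauss_angle_profile S N p I \<rho> h \<longleftrightarrow>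
     open I \<and> is_interval I \<and> I \<subseteq> {0<..<pi} \<and> gauss_angle N p \<in> I \<and>
     continuous_on I \<rho> \<and> continuous_on I h \<and>
     (\<exists>\<phi>. yz_point (\<rho> (gauss_angle N p)) (h (gauss_angle N p)) = rot_z \<phi> p) \<and>
     (\<forall>\<theta>\<in>I. yz_point (\<rho> \<theta>) (h \<theta>) \<in> S \<and>
            N (yz_point (\<rho> \<theta>) (h \<theta>)) = yz_point (sin \<theta>) (cos \<theta>) \<and>
            gauss_curvature S N (yz_point (\<rho> \<theta>) (h \<theta>)) \<noteq> 0)"

definition punctured_nbhd :: "real set \<Rightarrow> real \<Rightarrow> bool" where
  "punctured_nbhd U x \<longleftrightarrow> x \<notin> U \<and> x \<in> interior (insert x U)"

end

theory Submission
  imports Defs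
begin

text \<open>
  Since \<open>N\<close> is differentiable within \<open>S\<close> and commutes with the rotations, \<open>k1 = sin \<theta> / \<rho>\<close> off the
  axis. Comparing \<open>N (q t) - N (q \<theta>)\<close> with \<open>q t - q \<theta>\<close> along the profile curve \<open>q\<close> shows that the
  profile direction is principal and that \<open>\<rho>' = r2 cos \<theta>\<close>. Hence \<open>r1 = \<rho> / sin \<theta>\<close> satisfies
  \<open>r1' = (r2 - r1) cot \<theta>\<close>. If \<open>\<mu>\<close> were bounded, \<open>u = r1 - r0\<close> would satisfy \<open>\<bar>u'\<bar> \<le> C \<bar>u\<bar>\<close> to the right of
  \<open>\<theta>0\<close> with \<open>u \<theta>0 = 0\<close>, so \<open>u\<close> would vanish there by Gronwall, and then so would \<open>(r2 - r1) cot \<theta>\<close>,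
  contradicting \<open>r2 \<noteq> r1\<close>.
\<close>

section \<open>A Gronwall estimate\<close>

text \<open>The weight in \<open>v = u\<^sup>2 exp (- 2 C t)\<close> turns
  \<open>u g \<le> C u\<^sup>2\<close> into \<open>v' \<le> 0\<close>, so the nonnegative
  \<open>v\<close> cannot rise above \<open>v a = 0\<close>. The bound on \<open>g\<close> is asked
  for only where \<open>u\<close> is nonzero, because the quotient \<mu> is considered only where
  \<open>r1\<close> differs from \<open>r0\<close>; at zeros of \<open>u\<close> the inequality is
  trivial.\<close>

lemma gronwall_zero:
  fixes u g :: "real \<Rightarrow> real"
  assumes cont: "continuous_on {a..<b} u" and "u a = 0"
    and der: "\<And>t. a < t \<Longrightarrow> t < b \<Longrightarrow> (u has_real_derivative g t) (at t)"
    and bound: "\<And>t. a < t \<Longrightarrow> t < b \<Longrightarrow> u t \<noteq> 0 \<Longrightarrow> \<bar>g t\<bar> \<le> C * \<bar>u t\<bar>"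
    and t: "a < t" "t < b"
  shows "u t = 0"
proof -
  define v where "v = (\<lambda>t. (u t)\<^sup>2 * exp (- 2 * C * t))"
  have "v a \<ge> v t"
  proof (rule DERIV_nonpos_imp_decreasing_open[where f = v])
    show "a \<le> t" using t by simp
    show "continuous_on {a..t} v" unfolding v_def
      by (intro continuous_intros continuous_on_subset[OF cont]) (use t in auto)
    fix x assume x: "a < x" "x < t"
    have "(v has_real_derivative (2 * u x * g x - 2 * C * (u x)\<^sup>2) * exp (- 2 * C * x)) (at x)"
      unfolding v_def using der[of x] x t
      by (auto intro!: derivative_eq_intros simp: algebra_simps power2_eq_square)
    moreover have "u x * g x \<le> C * (u x)\<^sup>2"
    proof (cases "u x = 0")
      case False
      have "u x * g x \<le> \<bar>u x\<bar> * \<bar>g x\<bar>" by (metis abs_ge_self abs_mult)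
      also have "\<dots> \<le> \<bar>u x\<bar> * (C * \<bar>u x\<bar>)"
        by (rule mult_left_mono) (use bound[of x] x t False in auto)
      finally show ?thesis by (simp add: power2_eq_square ac_simps)
    qed simp
    then have "(2 * u x * g x - 2 * C * (u x)\<^sup>2) * exp (- 2 * C * x) \<le> 0"
      by (intro mult_nonpos_nonneg) auto
    ultimately show "\<exists>y. (v has_real_derivative y) (at x) \<and> y \<le> 0" by blast
  qed
  then show ?thesis
    using \<open>u a = 0\<close> by (simp add: v_def mult_le_0_iff)
qed

section \<open>Unit normals of a regular surface and their differentiability\<close>

text \<open>By Lagrange's identity \<open>n\<close> has zero cross product with
  \<open>cross3 a b\<close>, hence is parallel to it; normalisation leaves only the sign.\<close>

lemma unit_normal_eq_sgn_cross:
  fixes a b n :: "real^3"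
  assumes "cross3 a b \<noteq> 0" "n \<bullet> a = 0" "n \<bullet> b = 0" "norm n = 1"
  shows "n = sgn (cross3 a b) \<or> n = - sgn (cross3 a b)"
proof -
  have "cross3 n (cross3 a b) = 0" using assms by (simp add: Lagrange)
  then obtain c where c: "cross3 a b = c *\<^sub>R n"
    using assms by (auto simp: cross_eq_0 collinear_lemma)
  then have "c \<noteq> 0" using assms by auto
  then have "sgn (cross3 a b) = (if c > 0 then n else - n)"
    using c assms(4) by (simp add: sgn_div_norm sgn_scaleR)
  then show ?thesis by auto
qed

text \<open>The chart carries a short segment \<open>u + t v\<close> to a curve in \<open>S\<close>
  with velocity \<open>L v\<close>. This links the tangent space, defined by curves, to
  charts.\<close>

lemma chart_derivative_in_tangent_space:
  assumes "(X has_derivative L) (at u)" "open W" "u \<in> W" "X ` W \<subseteq> S"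
  shows "L v \<in> tangent_space S (X u)"
proof -
  define c where "c = (\<lambda>t. X (u + t *\<^sub>R v))"
  have "((\<lambda>t::real. u + t *\<^sub>R v) \<longlongrightarrow> u + 0 *\<^sub>R v) (at 0)" by (intro tendsto_intros)
  then have "\<forall>\<^sub>F t::real in at 0. u + t *\<^sub>R v \<in> W"
    using assms by (auto intro: topological_tendstoD)
  then obtain d where d: "d > 0" "\<And>t. t \<noteq> 0 \<Longrightarrow> \<bar>t\<bar> < d \<Longrightarrow> u + t *\<^sub>R v \<in> W"
    unfolding eventually_at by (auto simp: dist_real_def)
  have W: "u + t *\<^sub>R v \<in> W" if "\<bar>t\<bar> < d" for t
    using d(2)[of t] assms(3) that by (cases "t = 0") auto
  have "(c has_derivative (\<lambda>t. L (t *\<^sub>R v))) (at 0)"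
    unfolding c_def
    by (rule has_derivative_compose[of "\<lambda>t::real. u + t *\<^sub>R v", where g = X])
      (auto intro!: derivative_eq_intros simp: assms)
  then have "(c has_vector_derivative L v) (at 0)"
    using assms(1)
    by (simp add: has_vector_derivative_def has_derivative_def linear_cmul bounded_linear.linear)
  then show ?thesis
    unfolding tangent_space_def using d(1) W assms(4) \<open>(c has_vector_derivative L v) (at 0)\<close>
    by (intro CollectI exI[of _ c] exI[of _ d]) (force simp: c_def)
qed

lemma regular_C2_surface_chartE:
  assumes "regular_C2_surface S" "q \<in> S"
  obtains V :: "(real^3) set" and W :: "(real^2) set" and X Y L f'' where "open V" "q \<in> V" "open W" "homeomorphism W (S \<inter> V) X Y"
    "\<And>u. u \<in> W \<Longrightarrow> (X has_derivative blinfun_apply (L u)) (at u)"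
    "\<And>u. u \<in> W \<Longrightarrow> (L has_derivative blinfun_apply (f'' u)) (at u)"
    "\<And>u. u \<in> W \<Longrightarrow> inj (blinfun_apply (L u))"
proof -
  from assms obtain V :: "(real^3) set" and W :: "(real^2) set" and X Y where *: "open V" "q \<in> V" "C2_on X W"
    "\<forall>u\<in>W. inj (frechet_derivative X (at u))" "homeomorphism W (S \<inter> V) X Y"
    unfolding regular_C2_surface_def by meson
  then obtain L f'' where **: "open W"
    "\<And>u. u \<in> W \<Longrightarrow> (X has_derivative blinfun_apply (L u)) (at u)"
    "\<And>u. u \<in> W \<Longrightarrow> (L has_derivative blinfun_apply (f'' u)) (at u)"
    unfolding C2_on_def by blast
  show thesis
    by (rule that[OF *(1,2) **(1) *(5) **(2,3)]) (use * ** frechet_derivative_at in force)+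
qed

text \<open>Collinear images would pull back along the injective \<open>L\<close> to collinear
  coordinate vectors.\<close>

lemma cross_injective_nonzero:
  fixes L :: "real^2 \<Rightarrow> real^3"
  assumes "linear L" "inj L"
  shows "cross3 (L (axis 1 1)) (L (axis 2 1)) \<noteq> 0"
proof
  assume "cross3 (L (axis 1 1)) (L (axis 2 1)) = 0"
  moreover have "L (axis i 1) \<noteq> 0" for i
    using assms by (metis axis_eq_0_iff linear_injective_0 zero_neq_one)
  ultimately obtain c where "L (axis 2 1) = c *\<^sub>R L (axis 1 1)"
    by (auto simp: cross_eq_0 collinear_lemma)
  then have "L (axis 2 1) = L (c *\<^sub>R axis 1 1)" using assms by (simp add: linear_cmul)
  then have "axis 2 1 = c *\<^sub>R (axis 1 1 :: real^2)" using assms by (meson injD)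
  then have "(axis 2 1 :: real^2) $ 2 = (c *\<^sub>R axis 1 1 :: real^2) $ 2" by simp
  then show False by (simp add: axis_def)
qed

text \<open>Both vectors are, up to sign, the normalised cross product of the same two chart
  derivatives.\<close>

lemma unit_normal_unique_up_to_sign:
  assumes "regular_C2_surface S" "q \<in> S"
    and "norm m = 1" "\<And>v. v \<in> tangent_space S q \<Longrightarrow> m \<bullet> v = 0"
    and "norm n = 1" "\<And>v. v \<in> tangent_space S q \<Longrightarrow> n \<bullet> v = 0"
  shows "m = n \<or> m = - n"
proof -
  obtain V and W :: "(real^2) set" and X Y L f'' where ch: "open V" "q \<in> V" "open W" "homeomorphism W (S \<inter> V) X Y"
    "\<And>u. u \<in> W \<Longrightarrow> (X has_derivative blinfun_apply (L u)) (at u)"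
    "\<And>u. u \<in> W \<Longrightarrow> inj (blinfun_apply (L u))"
    using regular_C2_surface_chartE[OF assms(1,2)] by metis
  define u where "u = Y q"
  have u: "u \<in> W" "X u = q" "X ` W \<subseteq> S"
    using ch(2,4) assms(2) by (auto simp: u_def homeomorphism_def)
  have T: "L u v \<in> tangent_space S q" for v
    using chart_derivative_in_tangent_space[OF ch(5)[OF u(1)] ch(3) u(1,3)] u(2) by simp
  have nz: "cross3 (L u (axis 1 1)) (L u (axis 2 1)) \<noteq> 0"
    by (rule cross_injective_nonzero) (auto intro: ch u bounded_linear.linear blinfun.bounded_linear_right)
  show ?thesis
    using unit_normal_eq_sgn_cross[OF nz, of m] unit_normal_eq_sgn_cross[OF nz, of n] assms T by auto
qed

text \<open>Only continuity of \<open>N\<close> is given. Differentiability comes from a chart: the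
  normalised cross product of its partial derivatives is differentiable, and \<open>N\<close> equals
  it up to a sign that continuity makes locally constant. The second claim expresses tangency
  without curves: the height over the tangent plane is \<open>o(norm (x - q))\<close> on
  \<open>S\<close>.\<close>

lemma unit_normal_field_differentiable:
  assumes S: "regular_C2_surface S" and N: "unit_normal_field S N" and q: "q \<in> S"
  shows "\<exists>A. (N has_derivative A) (at q within S)"
    and "((\<lambda>x. N q \<bullet> x) has_derivative (\<lambda>_. 0)) (at q within S)"
proof -
  obtain V and W :: "(real^2) set" and X Y L f'' where ch: "open V" "q \<in> V" "open W" "homeomorphism W (S \<inter> V) X Y"
    "\<And>u. u \<in> W \<Longrightarrow> (X has_derivative blinfun_apply (L u)) (at u)"
    "\<And>u. u \<in> W \<Longrightarrow> (L has_derivative blinfun_apply (f'' u)) (at u)"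
    "\<And>u. u \<in> W \<Longrightarrow> inj (blinfun_apply (L u))"
    using regular_C2_surface_chartE[OF S q] by metis
  define u where "u = Y q"
  have u: "u \<in> W" "X u = q" and X: "X ` W = S \<inter> V" and Y: "Y ` (S \<inter> V) = W"
    and YX: "\<And>w. w \<in> W \<Longrightarrow> Y (X w) = w" and XY: "\<And>x. x \<in> S \<inter> V \<Longrightarrow> X (Y x) = x"
    and contY: "continuous_on (S \<inter> V) Y"
    using ch(2,4) q by (auto simp: u_def homeomorphism_def)
  have atS: "at q within S \<inter> V = at q within S"
    by (rule at_within_nhd[of _ V]) (use ch in auto)
  have lin: "linear (blinfun_apply (L w))" for w
    by (simp add: bounded_linear.linear blinfun.bounded_linear_right)
  \<comment> \<open>A left inverse of the injective \<open>L u\<close> serves as the derivative of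
    the chart inverse \<open>Y\<close>, taken within the surface only.\<close>
  obtain G where G: "linear G" "G \<circ> blinfun_apply (L u) = id"
    using linear_injective_left_inverse[OF lin ch(7)[OF u(1)]] by blast
  have derY: "(Y has_derivative G) (at q within S \<inter> V)"
    using has_derivative_inverse_within[where f = X and S = W and a = u and g = Y and f' = "L u" and g' = G]
      ch(5)[OF u(1)] contY u X G YX q ch(2)
    by (auto simp: continuous_on_eq_continuous_within has_derivative_at_withinI)
  have tangent: "N (X w) \<bullet> L w v = 0" if "w \<in> W" for w v
    using chart_derivative_in_tangent_space[OF ch(5)[OF that] ch(3) that, of S v] X N that
    by (auto simp: unit_normal_field_def)
  have derX: "(X has_derivative L u) (at (Y q))"
    using ch(5)[OF u(1)] u by (simp add: u_def)
  \<comment> \<open>On the surface \<open>X\<close> after \<open>Y\<close> is the identity, so the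
    identity has a derivative within \<open>S\<close> with tangent values only; pairing with
    \<open>N q\<close> annihilates it.\<close>
  have "((\<lambda>x. X (Y x)) has_derivative (\<lambda>v. L u (G v))) (at q within S \<inter> V)"
    by (rule has_derivative_compose[OF derY derX])
  then have "((\<lambda>x. x) has_derivative (\<lambda>v. L u (G v))) (at q within S \<inter> V)"
    by (rule has_derivative_transform[rotated 2]) (use XY q ch(2) in auto)
  then have "((\<lambda>x. N q \<bullet> x) has_derivative (\<lambda>v. N q \<bullet> L u (G v))) (at q within S \<inter> V)"
    by (rule has_derivative_inner_right)
  then show "((\<lambda>x. N q \<bullet> x) has_derivative (\<lambda>_. 0)) (at q within S)"
    using tangent[OF u(1)] u by (simp add: atS)
  define M where "M w = cross3 (L w (axis 1 1)) (L w (axis 2 1))" for w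
  have Mnz: "M w \<noteq> 0" if "w \<in> W" for w
    unfolding M_def by (rule cross_injective_nonzero[OF lin ch(7)[OF that]])
  have "\<exists>M'. (M has_derivative M') (at u)"
    unfolding M_def
    by (rule exI, rule bounded_bilinear.FDERIV[OF bilinear_cross[unfolded bilinear_conv_bounded_bilinear]])
      (rule bounded_linear.has_derivative[OF blinfun.bounded_linear_left ch(6)[OF u(1)]])+
  then obtain M' where M': "(M has_derivative M') (at u)" ..
  define \<nu> where "\<nu> w = inverse (norm (M w)) *\<^sub>R M w" for w
  have "\<nu> differentiable (at u)"
    unfolding \<nu>_def
    by (intro derivative_intros) (use M' Mnz[OF u(1)] in \<open>auto simp: differentiable_def
      intro!: exI has_derivative_compose[OF M' has_derivative_norm]\<close>)
  then obtain \<nu>' where "(\<nu> has_derivative \<nu>') (at (Y q))"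
    unfolding differentiable_def u_def by blast
  from has_derivative_compose[OF derY this]
  have der: "((\<lambda>x. \<nu> (Y x)) has_derivative (\<lambda>v. \<nu>' (G v))) (at q within S)" by (simp add: atS)
  have pm: "N x = \<nu> (Y x) \<or> N x = - \<nu> (Y x)" if "x \<in> S \<inter> V" for x
    using unit_normal_eq_sgn_cross[of "L (Y x) (axis 1 1)" "L (Y x) (axis 2 1)" "N x"]
      Mnz[of "Y x"] tangent[of "Y x"] XY[OF that] Y that N
    by (auto simp: M_def \<nu>_def sgn_div_norm unit_normal_field_def image_iff)
  have nrm: "norm (\<nu> (Y x)) = 1" if "x \<in> S \<inter> V" for x
    using Mnz[of "Y x"] Y that by (auto simp: \<nu>_def)
  \<comment> \<open>The sign relating \<open>N\<close> to the chart normal, written as an inner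
    product so that its continuity is visible.\<close>
  define s where "s x = N x \<bullet> \<nu> (Y x)" for x
  have s: "N x = s x *\<^sub>R \<nu> (Y x) \<and> (s x = 1 \<or> s x = -1)" if "x \<in> S \<inter> V" for x
    using pm[OF that] nrm[OF that] by (auto simp: s_def dot_square_norm)
  have "continuous (at q within S) s"
    unfolding s_def
    using N q has_derivative_continuous[OF der]
    by (intro continuous_intros) (auto simp: unit_normal_field_def continuous_on_eq_continuous_within)
  \<comment> \<open>The two possible signs are at distance 2, so values closer than 1
    coincide.\<close>
  then have "\<forall>\<^sub>F x in at q within S. dist (s x) (s q) < 1"
    by (auto simp: continuous_within intro: tendstoD)
  moreover have "\<forall>\<^sub>F x in at q within S. x \<in> S \<inter> V"
    using ch(1,2) by (auto simp: eventually_at_topological)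
  ultimately have ev: "\<forall>\<^sub>F x in at q within S. s q *\<^sub>R \<nu> (Y x) = N x"
  proof eventually_elim
    case (elim x)
    then show ?case using s[of x] s[of q] q ch(2) by (auto simp: dist_real_def)
  qed
  have "((\<lambda>x. s q *\<^sub>R \<nu> (Y x)) has_derivative (\<lambda>v. s q *\<^sub>R \<nu>' (G v))) (at q within S)"
    by (intro derivative_intros der)
  then have "(N has_derivative (\<lambda>v. s q *\<^sub>R \<nu>' (G v))) (at q within S)"
    by (rule has_derivative_transform_eventually[OF _ ev]) (use s q ch(2) in auto)
  then show "\<exists>A. (N has_derivative A) (at q within S)" by blast
qed

section \<open>Rotations about the axis and equivariance of the normal\<close>

lemma rot_z_nth [simp]:
  "rot_z \<phi> q $ 1 = cos \<phi> * q$1 - sin \<phi> * q$2"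
  "rot_z \<phi> q $ 2 = sin \<phi> * q$1 + cos \<phi> * q$2"
  "rot_z \<phi> q $ 3 = q$3"
  by (simp_all add: rot_z_def)

lemma rot_z_0 [simp]: "rot_z 0 q = q"
  by (simp add: vec_eq_iff forall_3)

text \<open>Separates the angle from the point, so that continuity and derivatives in the angle can
  be read off.\<close>

lemma rot_z_sum:
  "rot_z \<phi> q = cos \<phi> *\<^sub>R vector [q$1, q$2, 0] + sin \<phi> *\<^sub>R parallel_dir q + vector [0, 0, q$3]"
  by (simp add: vec_eq_iff forall_3 parallel_dir_def)

lemma rot_z_inverse [simp]: "rot_z (- \<phi>) (rot_z \<phi> q) = q" "rot_z \<phi> (rot_z (- \<phi>) q) = q"
proof -
  have *: "rot_z (- \<phi>) (rot_z \<phi> q) = q" for \<phi>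
  proof -
    have "cos \<phi> * (cos \<phi> * a - sin \<phi> * b) + sin \<phi> * (sin \<phi> * a + cos \<phi> * b) = a"
      "cos \<phi> * (sin \<phi> * a + cos \<phi> * b) - sin \<phi> * (cos \<phi> * a - sin \<phi> * b) = b" for a b
      using sin_cos_squared_add[of \<phi>] by algebra+
    then show ?thesis by (simp add: vec_eq_iff forall_3)
  qed
  show "rot_z (- \<phi>) (rot_z \<phi> q) = q" "rot_z \<phi> (rot_z (- \<phi>) q) = q"
    using *[of \<phi>] *[of "- \<phi>"] by simp_all
qed

lemma rot_z_inner: "rot_z \<phi> a \<bullet> rot_z \<phi> b = a \<bullet> b"
proof -
  have "(cos \<phi> * a1 - sin \<phi> * a2) * (cos \<phi> * b1 - sin \<phi> * b2)
     + (sin \<phi> * a1 + cos \<phi> * a2) * (sin \<phi> * b1 + cos \<phi> * b2) = a1 * b1 + a2 * b2" for a1 a2 b1 b2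
    using sin_cos_squared_add[of \<phi>] by algebra
  then show ?thesis by (simp add: inner_vec_def sum_3)
qed

lemma norm_rot_z: "norm (rot_z \<phi> a) = norm a"
  by (simp add: norm_eq_sqrt_inner rot_z_inner)

lemma bounded_linear_rot_z: "bounded_linear (rot_z \<phi>)"
  by (rule linear_conv_bounded_linear[THEN iffD1])
    (auto intro!: linearI simp: vec_eq_iff forall_3 algebra_simps)

lemma rot_z_has_vector_derivative:
  "((\<lambda>\<phi>. rot_z \<phi> q) has_vector_derivative parallel_dir q) (at 0)"
  unfolding rot_z_sum by (auto intro!: derivative_eq_intros)

lemma tangent_space_rot_z:
  assumes "rot_z \<phi> ` S = S" "v \<in> tangent_space S q"
  shows "rot_z \<phi> v \<in> tangent_space S (rot_z \<phi> q)"
proof -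
  from assms(2) obtain c e where c: "e > 0" "c 0 = q" "\<forall>t\<in>{-e<..<e}. c t \<in> S"
    "(c has_vector_derivative v) (at 0)" unfolding tangent_space_def by blast
  have "((\<lambda>t. rot_z \<phi> (c t)) has_vector_derivative rot_z \<phi> v) (at 0)"
    using bounded_linear.has_vector_derivative[OF bounded_linear_rot_z c(4)] .
  then show ?thesis
    unfolding tangent_space_def using c assms(1)
    by (auto intro!: exI[of _ "\<lambda>t. rot_z \<phi> (c t)"] exI[of _ e])
qed

text \<open>Rotating the normal at the rotated point back gives a unit normal at \<open>q\<close>,
  hence \<open>N q\<close> up to sign. The sign is continuous in the angle and equals 1 at angle
  0.\<close>

lemma unit_normal_field_rot_z:
  assumes S: "oriented_C2_surface_of_revolution S N" and q: "q \<in> S"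
  shows "N (rot_z \<phi> q) = rot_z \<phi> (N q)"
proof -
  have reg: "regular_C2_surface S" and N: "unit_normal_field S N" and rot: "\<And>\<phi>. rot_z \<phi> ` S = S"
    using S by (auto simp: oriented_C2_surface_of_revolution_def)
  have inS: "rot_z \<phi> q \<in> S" for \<phi> using rot q by blast
  define s where "s \<phi> = rot_z (- \<phi>) (N (rot_z \<phi> q)) \<bullet> N q" for \<phi>
  have pm: "rot_z (- \<phi>) (N (rot_z \<phi> q)) = N q \<or> rot_z (- \<phi>) (N (rot_z \<phi> q)) = - N q" for \<phi>
  proof (rule unit_normal_unique_up_to_sign[OF reg q])
    show "norm (rot_z (- \<phi>) (N (rot_z \<phi> q))) = 1" "norm (N q) = 1"
      using N inS q by (auto simp: norm_rot_z unit_normal_field_def)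
    show "N q \<bullet> v = 0" if "v \<in> tangent_space S q" for v
      using N that q by (auto simp: unit_normal_field_def)
    show "rot_z (- \<phi>) (N (rot_z \<phi> q)) \<bullet> v = 0" if "v \<in> tangent_space S q" for v
    proof -
      have "N (rot_z \<phi> q) \<bullet> rot_z \<phi> v = 0"
        using tangent_space_rot_z[OF rot that] N inS by (auto simp: unit_normal_field_def)
      then show ?thesis using rot_z_inner[of \<phi> "rot_z (- \<phi>) (N (rot_z \<phi> q))" v] by simp
    qed
  qed
  have nq: "N q \<bullet> N q = 1" using N q by (simp add: unit_normal_field_def dot_square_norm)
  have s_pm: "s \<phi> = 1 \<or> s \<phi> = -1" for \<phi> using pm[of \<phi>] nq by (auto simp: s_def)
  have crot: "continuous_on UNIV (\<lambda>\<phi>. rot_z \<phi> q)"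
    unfolding rot_z_sum by (intro continuous_intros)
  have cN: "continuous_on UNIV (\<lambda>\<phi>. N (rot_z \<phi> q))"
    by (rule continuous_on_compose2[of S N]) (use N inS crot in \<open>auto simp: unit_normal_field_def\<close>)
  \<comment> \<open>Moving the rotation to the fixed vector \<open>N q\<close> leaves two factors
    that are plainly continuous in the angle.\<close>
  have "s = (\<lambda>\<phi>. N (rot_z \<phi> q) \<bullet> rot_z \<phi> (N q))"
    using rot_z_inner[of "\<phi>" "rot_z (-\<phi>) (N (rot_z \<phi> q))" "N q" for \<phi>] by (auto simp: s_def)
  then have "continuous_on UNIV s"
    by (simp add: rot_z_sum[of _ "N q"]) (intro continuous_intros cN)
  then have "s constant_on UNIV"
    by (rule continuous_finite_range_constant[rotated])
      (use s_pm finite_subset[of "range s" "{1,-1}"] in auto)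
  moreover have "s 0 = 1"
    using nq by (simp add: s_def)
  ultimately have "s \<phi> = 1" by (auto simp: constant_on_def)
  then have "rot_z (- \<phi>) (N (rot_z \<phi> q)) = N q" using pm[of \<phi>] nq by (auto simp: s_def)
  then show ?thesis by (metis rot_z_inverse(2))
qed

section \<open>The differential of the Gauss map on the two principal directions\<close>

text \<open>Differentiate the equivariance \<open>N (rot_z \<phi> q) = rot_z \<phi> (N q)\<close> at
  angle 0, once by the chain rule and once directly.\<close>

lemma shape_operator_parallel:
  assumes S: "oriented_C2_surface_of_revolution S N" and q: "q \<in> S"
    and A: "(N has_derivative A) (at q within S)"
  shows "A (parallel_dir q) = parallel_dir (N q)"
proof -
  have inS: "rot_z \<phi> q \<in> S" for \<phi>
    using S q unfolding oriented_C2_surface_of_revolution_def by blast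
  have "((\<lambda>\<phi>. rot_z \<phi> q) has_derivative (\<lambda>t. t *\<^sub>R parallel_dir q)) (at 0)"
    using rot_z_has_vector_derivative by (simp add: has_vector_derivative_def)
  moreover have "(N has_derivative A) (at (rot_z 0 q) within (\<lambda>\<phi>. rot_z \<phi> q) ` UNIV)"
    by (rule has_derivative_subset[of _ _ _ S]) (use A inS in auto)
  ultimately have "((\<lambda>\<phi>. N (rot_z \<phi> q)) has_derivative (\<lambda>t. A (t *\<^sub>R parallel_dir q))) (at 0)"
    using has_derivative_in_compose[of "\<lambda>\<phi>. rot_z \<phi> q" _ 0 UNIV N A] by simp
  moreover have "((\<lambda>\<phi>. N (rot_z \<phi> q)) has_derivative (\<lambda>t. t *\<^sub>R parallel_dir (N q))) (at 0)"
    using rot_z_has_vector_derivative[of "N q"] unit_normal_field_rot_z[OF S q]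
    by (simp add: has_vector_derivative_def)
  ultimately have "(\<lambda>t::real. A (t *\<^sub>R parallel_dir q)) = (\<lambda>t. t *\<^sub>R parallel_dir (N q))"
    by (rule has_derivative_unique)
  then show ?thesis by (metis scaleR_one)
qed


text \<open>A derivative within \<open>S\<close> is not unique as a linear map on space, so the
  eigenvalue equation is required for every such \<open>A\<close>; this makes the description in
  \<open>principal_curvature_along\<close> single-valued.\<close>

lemma principal_curvature_along_eqI:
  assumes "\<exists>A. (N has_derivative A) (at q within S)"
    and "\<And>A. (N has_derivative A) (at q within S) \<Longrightarrow> A v = k *\<^sub>R v" "v \<noteq> 0"
  shows "principal_curvature_along S N q v = k"
  unfolding principal_curvature_along_def
proof (rule the_equality)
  show "\<exists>A. (N has_derivative A) (at q within S) \<and> A v = k *\<^sub>R v"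
    using assms by blast
qed (use assms(2,3) in force)

text \<open>The curve \<open>q\<close> is not assumed differentiable: it only has to approach \<open>x\<close> asymptotically in the
  direction \<open>T\<close>. This is how the differentiability of the profile curve is recovered from that of \<open>N\<close>.\<close>
lemma tendsto_difference_quotient_along:
  fixes f :: "'a::real_normed_vector \<Rightarrow> 'b::real_normed_vector"
  assumes f: "(f has_derivative A) (at x within S)"
    and lim: "filterlim q (at x within S) F"
    and d: "\<And>t. q t - x = a t *\<^sub>R T + b t *\<^sub>R n" and unit: "norm T = 1" "norm n = 1"
    and b: "((\<lambda>t. b t / norm (q t - x)) \<longlongrightarrow> 0) F"
  shows "\<forall>\<^sub>F t in F. a t \<noteq> 0" "((\<lambda>t. b t / a t) \<longlongrightarrow> 0) F"
    "((\<lambda>t. (f (q t) - f x) /\<^sub>R a t) \<longlongrightarrow> A T) F"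
proof -
  interpret A: bounded_linear A using f by (rule has_derivative_bounded_linear)
  have neq: "\<forall>\<^sub>F t in F. q t \<noteq> x"
    using lim by (auto simp: filterlim_at elim: eventually_mono)
  \<comment> \<open>Once \<open>b\<close> is below half the chord length, the triangle inequality
    gives \<open>a\<close> at least the other half; dividing by \<open>a\<close> instead of the
    chord length then costs only a factor 2.\<close>
  have "\<forall>\<^sub>F t in F. \<bar>b t / norm (q t - x)\<bar> < 1/2"
    using tendstoD[OF b, of "1/2"] by (simp add: dist_real_def)
  with neq have small: "\<forall>\<^sub>F t in F. q t \<noteq> x \<and> a t \<noteq> 0 \<and> norm (q t - x) \<le> 2 * \<bar>a t\<bar>"
  proof eventually_elim
    case (elim t)
    then have "2 * \<bar>b t\<bar> < norm (q t - x)"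
      by (simp add: field_simps)
    moreover have "norm (q t - x) \<le> \<bar>a t\<bar> + \<bar>b t\<bar>"
      using norm_triangle_ineq[of "a t *\<^sub>R T" "b t *\<^sub>R n"] unit by (simp add: d)
    ultimately show ?case using elim by auto
  qed
  then show "\<forall>\<^sub>F t in F. a t \<noteq> 0" by (auto elim: eventually_mono)
  have le: "c / \<bar>a t\<bar> \<le> 2 * (c / norm (q t - x))"
    if "q t \<noteq> x \<and> a t \<noteq> 0 \<and> norm (q t - x) \<le> 2 * \<bar>a t\<bar>" "c \<ge> 0" for c t
    using mult_left_mono[of "norm (q t - x)" "2 * \<bar>a t\<bar>" c] that by (simp add: field_simps)
  have 0: "((\<lambda>t. 2 * \<bar>b t / norm (q t - x)\<bar>) \<longlongrightarrow> 0) F"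
    using tendsto_mult[OF tendsto_const[of 2] tendsto_rabs[OF b]] by simp
  show ba: "((\<lambda>t. b t / a t) \<longlongrightarrow> 0) F"
  proof (rule Lim_null_comparison[OF _ 0])
    show "\<forall>\<^sub>F t in F. norm (b t / a t) \<le> 2 * \<bar>b t / norm (q t - x)\<bar>"
      using small by eventually_elim (use le[of _ "\<bar>b _\<bar>"] in \<open>simp add: abs_divide\<close>)
  qed
  \<comment> \<open>The remainder of the linear approximation; the linear part divided by
    \<open>a\<close> is \<open>A T + (b / a) A n\<close>.\<close>
  define R where "R t = f (q t) - f x - A (q t - x)" for t
  have "((\<lambda>t. norm (R t) / norm (q t - x)) \<longlongrightarrow> 0) F"
    using filterlim_compose[OF _ lim] f unfolding has_derivative_iff_norm R_def by blast
  then have 1: "((\<lambda>t. 2 * (norm (R t) / norm (q t - x))) \<longlongrightarrow> 0) F"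
    using tendsto_mult[OF tendsto_const[of 2]] by fastforce
  have "((\<lambda>t. R t /\<^sub>R a t) \<longlongrightarrow> 0) F"
  proof (rule Lim_null_comparison[OF _ 1])
    show "\<forall>\<^sub>F t in F. norm (R t /\<^sub>R a t) \<le> 2 * (norm (R t) / norm (q t - x))"
      using small by eventually_elim (use le[of _ "norm (R _)"] in \<open>simp add: divide_inverse ac_simps\<close>)
  qed
  then have "((\<lambda>t. R t /\<^sub>R a t + A T + (b t / a t) *\<^sub>R A n) \<longlongrightarrow> 0 + A T + 0 *\<^sub>R A n) F"
    by (intro tendsto_intros ba)
  moreover have "\<forall>\<^sub>F t in F. R t /\<^sub>R a t + A T + (b t / a t) *\<^sub>R A n = (f (q t) - f x) /\<^sub>R a t"
    using small by eventually_elim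
      (simp add: R_def d A.add A.scaleR scaleR_diff_right scaleR_add_right divide_inverse ac_simps)
  ultimately show "((\<lambda>t. (f (q t) - f x) /\<^sub>R a t) \<longlongrightarrow> A T) F"
    by (simp add: tendsto_cong)
qed

lemma yz_point_nth [simp]: "yz_point y z $ 1 = 0" "yz_point y z $ 2 = y" "yz_point y z $ 3 = z"
  by (simp_all add: yz_point_def)

text \<open>With the Gauss angle as parameter the increment of \<open>N\<close> is explicit.
  Dividing it by the tangential part \<open>a\<close> of the chord gives \<open>A T = k T\<close>
  with \<open>k\<close> the limit of \<open>sin (t - \<theta>) / a t\<close>. For nonzero
  \<open>k\<close>, inverting that limit gives the growth rate \<open>1 / k\<close> of
  \<open>a\<close>, and with it the derivative of \<open>\<rho>\<close>.\<close>

lemma shape_operator_profile: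
  fixes \<rho> h :: "real \<Rightarrow> real"
  defines "q \<equiv> \<lambda>t. yz_point (\<rho> t) (h t)"
  assumes S: "oriented_C2_surface_of_revolution S N"
    and I: "open I" "I \<subseteq> {0<..<pi}" "\<theta> \<in> I" "continuous_on I \<rho>" "continuous_on I h"
    and q: "\<And>t. t \<in> I \<Longrightarrow> q t \<in> S" "\<And>t. t \<in> I \<Longrightarrow> N (q t) = yz_point (sin t) (cos t)"
  obtains k where
    "\<And>A. (N has_derivative A) (at (q \<theta>) within S) \<Longrightarrow>
       A (yz_point (cos \<theta>) (- sin \<theta>)) = k *\<^sub>R yz_point (cos \<theta>) (- sin \<theta>)"
    "k \<noteq> 0 \<Longrightarrow> (\<rho> has_real_derivative cos \<theta> / k) (at \<theta>)"
proof -
  have reg: "regular_C2_surface S" and N: "unit_normal_field S N"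
    using S by (auto simp: oriented_C2_surface_of_revolution_def)
  define T where "T = yz_point (cos \<theta>) (- sin \<theta>)"
  define n where "n = yz_point (sin \<theta>) (cos \<theta>)"
  \<comment> \<open>Coordinates of the chord \<open>q t - q \<theta>\<close> in the orthonormal
    frame of tangent \<open>T\<close> and normal \<open>n\<close> at \<theta>.\<close>
  define a where "a t = (\<rho> t - \<rho> \<theta>) * cos \<theta> - (h t - h \<theta>) * sin \<theta>" for t
  define b where "b t = (\<rho> t - \<rho> \<theta>) * sin \<theta> + (h t - h \<theta>) * cos \<theta>" for t
  have sc: "sin \<theta> * sin \<theta> + cos \<theta> * cos \<theta> = 1"
    using sin_cos_squared_add[of \<theta>] by (simp add: power2_eq_square)
  have \<rho>: "\<rho> t - \<rho> \<theta> = a t * cos \<theta> + b t * sin \<theta>" for t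
    unfolding a_def b_def using sc by algebra
  have h: "h t - h \<theta> = - a t * sin \<theta> + b t * cos \<theta>" for t
    unfolding a_def b_def using sc by algebra
  have d: "q t - q \<theta> = a t *\<^sub>R T + b t *\<^sub>R n" for t
    using \<rho>[of t] h[of t] by (simp add: vec_eq_iff forall_3 T_def n_def q_def)
  have unit: "norm T = 1" "norm n = 1"
    using sc by (simp_all add: T_def n_def norm_eq_sqrt_inner inner_vec_def sum_3)
  have ev: "\<forall>\<^sub>F t in at \<theta>. t \<in> I \<and> t \<noteq> \<theta>"
    using I(1,3) by (auto simp: eventually_at_topological)
  have cq: "(q \<longlongrightarrow> q \<theta>) (at \<theta>)"
  proof (rule vec_tendstoI)
    fix i :: 3
    have "(\<rho> \<longlongrightarrow> \<rho> \<theta>) (at \<theta>)" "(h \<longlongrightarrow> h \<theta>) (at \<theta>)"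
      using I by (auto simp: continuous_on_eq_continuous_at isCont_def)
    then show "((\<lambda>t. q t $ i) \<longlongrightarrow> q \<theta> $ i) (at \<theta>)"
      using exhaust_3[of i] by (auto simp: q_def)
  qed
  \<comment> \<open>The point determines its normal, and the normal determines the Gauss angle
    because cosine is injective on \<open>[0, pi]\<close>.\<close>
  have qneq: "q t \<noteq> q \<theta>" if "t \<in> I" "t \<noteq> \<theta>" for t
  proof
    assume "q t = q \<theta>"
    then have "cos t = cos \<theta>" using q(2)[OF that(1)] q(2)[OF I(3)] by (metis yz_point_nth(3))
    then show False using that I(2,3) cos_inj_pi[of t \<theta>] by force
  qed
  have lim: "filterlim q (at (q \<theta>) within S) (at \<theta>)"
    unfolding filterlim_at
  proof
    show "\<forall>\<^sub>F t in at \<theta>. q t \<in> S \<and> q t \<noteq> q \<theta>"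
      using ev by eventually_elim (use q(1) qneq in auto)
  qed (rule cq)
  have Nq: "N (q \<theta>) = n" using q(2)[OF I(3)] by (simp add: n_def)
  have nd: "n \<bullet> (q t - q \<theta>) = b t" for t
    using sc by (simp add: n_def q_def b_def inner_vec_def sum_3 algebra_simps)
  \<comment> \<open>The tangency statement for the surface, composed with the profile curve, makes
    the normal part \<open>b\<close> of the chord negligible.\<close>
  have "((\<lambda>y. norm (n \<bullet> y - n \<bullet> q \<theta> - 0) / norm (y - q \<theta>)) \<longlongrightarrow> 0) (at (q \<theta>) within S)"
    using unit_normal_field_differentiable(2)[OF reg N q(1)[OF I(3)]] Nq
    by (simp add: has_derivative_iff_norm)
  from filterlim_compose[OF this lim]
  have "((\<lambda>t. \<bar>b t / norm (q t - q \<theta>)\<bar>) \<longlongrightarrow> 0) (at \<theta>)"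
    by (simp add: nd inner_diff_right[symmetric] abs_divide)
  then have blim: "((\<lambda>t. b t / norm (q t - q \<theta>)) \<longlongrightarrow> 0) (at \<theta>)"
    by (rule tendsto_rabs_zero_cancel)
  obtain A0 where A0: "(N has_derivative A0) (at (q \<theta>) within S)"
    using unit_normal_field_differentiable(1)[OF reg N q(1)[OF I(3)]] by blast
  note quot = tendsto_difference_quotient_along[OF _ lim d unit blim]
  define k where "k = A0 T \<bullet> T"
  \<comment> \<open>The normal turns by exactly \<open>t - \<theta>\<close> in the plane; these are
    the addition formulas in the frame \<open>T\<close>, \<open>n\<close>.\<close>
  have eqs: "N (q t) - N (q \<theta>) = sin (t - \<theta>) *\<^sub>R T + (cos (t - \<theta>) - 1) *\<^sub>R n" if "t \<in> I" for t
    unfolding q(2)[OF that] Nq using sc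
    by (auto simp: vec_eq_iff forall_3 T_def n_def sin_diff cos_diff) algebra+
  have TT: "T \<bullet> T = 1" "n \<bullet> n = 1" "T \<bullet> n = 0" "n \<bullet> T = 0"
    using unit by (simp_all add: dot_square_norm) (simp_all add: T_def n_def inner_vec_def sum_3)
  have evI: "\<forall>\<^sub>F t in at \<theta>. t \<in> I" using ev by (auto elim: eventually_mono)
  have "((\<lambda>t. ((N (q t) - N (q \<theta>)) /\<^sub>R a t) \<bullet> T) \<longlongrightarrow> k) (at \<theta>)"
    unfolding k_def by (intro tendsto_intros quot(3) A0)
  moreover have "\<forall>\<^sub>F t in at \<theta>. ((N (q t) - N (q \<theta>)) /\<^sub>R a t) \<bullet> T = sin (t - \<theta>) / a t"
    using evI by eventually_elim (simp add: eqs TT inner_add_left divide_inverse)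
  ultimately have klim: "((\<lambda>t. sin (t - \<theta>) / a t) \<longlongrightarrow> k) (at \<theta>)"
    by (simp add: tendsto_cong)
  have sin0: "((\<lambda>t. sin (t - \<theta>) / (t - \<theta>)) \<longlongrightarrow> 1) (at \<theta>)"
    using DERIV_sin[of 0] by (simp add: has_field_derivative_iff LIM_offset_zero_iff[where a = \<theta>])
  have cos0: "((\<lambda>t. (cos (t - \<theta>) - 1) / (t - \<theta>)) \<longlongrightarrow> 0) (at \<theta>)"
    using DERIV_cos[of 0] by (simp add: has_field_derivative_iff LIM_offset_zero_iff[where a = \<theta>])
  have sinnz: "\<forall>\<^sub>F t in at \<theta>. sin (t - \<theta>) \<noteq> 0"
    using tendsto_imp_eventually_ne[OF sin0, of 0] by (auto elim: eventually_mono)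
  have perp: "A0 T \<bullet> n = 0"
  proof -
    have "((\<lambda>t. ((N (q t) - N (q \<theta>)) /\<^sub>R a t) \<bullet> n) \<longlongrightarrow> A0 T \<bullet> n) (at \<theta>)"
      by (intro tendsto_intros quot(3) A0)
    \<comment> \<open>The normal component is \<open>(cos (t - \<theta>) - 1) / a t\<close>, of
      second order in the angle; it is compared with \<open>sin (t - \<theta>) / a t\<close>, whose
      limit is \<open>k\<close>.\<close>
    moreover have "((\<lambda>t. ((N (q t) - N (q \<theta>)) /\<^sub>R a t) \<bullet> n) \<longlongrightarrow> 0 / 1 * k) (at \<theta>)"
    proof (rule Lim_transform_eventually)
      show "((\<lambda>t. ((cos (t - \<theta>) - 1) / (t - \<theta>)) / (sin (t - \<theta>) / (t - \<theta>)) * (sin (t - \<theta>) / a t))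
        \<longlongrightarrow> 0 / 1 * k) (at \<theta>)"
        by (intro tendsto_intros cos0 sin0 klim) auto
      show "\<forall>\<^sub>F t in at \<theta>. ((cos (t - \<theta>) - 1) / (t - \<theta>)) / (sin (t - \<theta>) / (t - \<theta>)) * (sin (t - \<theta>) / a t)
        = ((N (q t) - N (q \<theta>)) /\<^sub>R a t) \<bullet> n"
        using ev sinnz quot(1)[OF A0]
        by eventually_elim (simp add: eqs TT inner_add_left divide_simps)
    qed
    ultimately show ?thesis using tendsto_unique[of "at \<theta>"] by fastforce
  qed
  have comp1: "A0 T $ 1 = 0"
  proof -
    have "((\<lambda>t. ((N (q t) - N (q \<theta>)) /\<^sub>R a t) $ 1) \<longlongrightarrow> A0 T $ 1) (at \<theta>)"
      by (intro tendsto_vec_nth quot(3) A0)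
    moreover have "\<forall>\<^sub>F t in at \<theta>. ((N (q t) - N (q \<theta>)) /\<^sub>R a t) $ 1 = 0"
      using evI by eventually_elim (simp add: eqs T_def n_def)
    ultimately have "((\<lambda>t::real. 0) \<longlongrightarrow> A0 T $ 1) (at \<theta>)" by (rule Lim_transform_eventually)
    then show ?thesis using tendsto_unique[of "at \<theta>" "\<lambda>t::real. 0::real"] by fastforce
  qed
  have A0T: "A0 T = k *\<^sub>R T"
  proof -
    have e: "A0 T $ 2 * sin \<theta> + A0 T $ 3 * cos \<theta> = 0"
      using perp by (simp add: n_def inner_vec_def sum_3)
    have k: "k = A0 T $ 2 * cos \<theta> - A0 T $ 3 * sin \<theta>"
      by (simp add: k_def T_def inner_vec_def sum_3)
    have "A0 T $ 2 = k * cos \<theta>" "A0 T $ 3 = - k * sin \<theta>"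
      using e k sc by algebra+
    then show ?thesis using comp1 by (simp add: vec_eq_iff forall_3) (simp add: T_def)
  qed
  show thesis
  proof (rule that[of k])
    fix A assume "(N has_derivative A) (at (q \<theta>) within S)"
    \<comment> \<open>Both values are limits of the same difference quotients, so any two
      derivatives agree on \<open>T\<close>.\<close>
    then have "A T = A0 T"
      using tendsto_unique[OF _ quot(3) quot(3)[OF A0]] by simp
    then show "A (yz_point (cos \<theta>) (- sin \<theta>)) = k *\<^sub>R yz_point (cos \<theta>) (- sin \<theta>)"
      using A0T by (simp add: T_def)
  next
    assume "k \<noteq> 0"
    \<comment> \<open>The increment of \<open>\<rho>\<close> is
      \<open>a (cos \<theta> + (b / a) sin \<theta>)\<close>, and \<open>a / (t - \<theta>)\<close>
      is a quotient of two sine quotients with limits 1 and \<open>k\<close>.\<close>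
    have "((\<lambda>t. (\<rho> t - \<rho> \<theta>) / (t - \<theta>)) \<longlongrightarrow> (1 / k) * (cos \<theta> + 0 * sin \<theta>)) (at \<theta>)"
    proof (rule Lim_transform_eventually)
      show "((\<lambda>t. (sin (t - \<theta>) / (t - \<theta>)) / (sin (t - \<theta>) / a t) * (cos \<theta> + b t / a t * sin \<theta>))
        \<longlongrightarrow> (1 / k) * (cos \<theta> + 0 * sin \<theta>)) (at \<theta>)"
        by (intro tendsto_intros sin0 klim quot(2)[OF A0] \<open>k \<noteq> 0\<close>)
      show "\<forall>\<^sub>F t in at \<theta>. (sin (t - \<theta>) / (t - \<theta>)) / (sin (t - \<theta>) / a t) * (cos \<theta> + b t / a t * sin \<theta>)
        = (\<rho> t - \<rho> \<theta>) / (t - \<theta>)"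
        using ev sinnz quot(1)[OF A0]
        by eventually_elim (simp add: \<rho> field_simps)
    qed
    then show "(\<rho> has_real_derivative cos \<theta> / k) (at \<theta>)"
      by (simp add: has_field_derivative_iff)
  qed
qed

section \<open>Radii of curvature as functions of the Gauss angle\<close>

text \<open>Off the axis both principal directions are nonzero, so the eigenvalues found above are
  \<open>k1\<close> and \<open>k2\<close>; nonzero Gauss curvature makes \<open>k2\<close>
  invertible.\<close>

lemma gauss_angle_profile_radii:
  assumes S: "oriented_C2_surface_of_revolution S N"
    and prof: "gauss_angle_profile S N p I \<rho> h" and \<theta>: "\<theta> \<in> I" "\<rho> \<theta> \<noteq> 0"
  shows "radius1 S N (yz_point (\<rho> \<theta>) (h \<theta>)) = \<rho> \<theta> / sin \<theta>"
    and "(\<rho> has_real_derivative radius2 S N (yz_point (\<rho> \<theta>) (h \<theta>)) * cos \<theta>) (at \<theta>)"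
proof -
  define q where "q = yz_point (\<rho> \<theta>) (h \<theta>)"
  have I: "open I" "I \<subseteq> {0<..<pi}" "continuous_on I \<rho>" "continuous_on I h"
    and qS: "\<And>t. t \<in> I \<Longrightarrow> yz_point (\<rho> t) (h t) \<in> S"
    and qN: "\<And>t. t \<in> I \<Longrightarrow> N (yz_point (\<rho> t) (h t)) = yz_point (sin t) (cos t)"
    and K: "gauss_curvature S N q \<noteq> 0"
    using prof \<theta>(1) by (auto simp: gauss_angle_profile_def q_def)
  have q: "q \<in> S" "N q = yz_point (sin \<theta>) (cos \<theta>)" using qS qN \<theta>(1) by (auto simp: q_def)
  have ex: "\<exists>A. (N has_derivative A) (at q within S)"
    using S q(1) by (intro unit_normal_field_differentiable) (auto simp: oriented_C2_surface_of_revolution_def)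
  have pd: "parallel_dir q \<noteq> 0" "parallel_dir (N q) = (sin \<theta> / \<rho> \<theta>) *\<^sub>R parallel_dir q"
    using \<theta>(2) q(2) by (simp_all add: vec_eq_iff forall_3 parallel_dir_def) (simp_all add: q_def)
  have k1: "k1 S N q = sin \<theta> / \<rho> \<theta>"
    unfolding k1_def
    by (rule principal_curvature_along_eqI[OF ex _ pd(1)])
      (use shape_operator_parallel[OF S q(1)] pd(2) in simp)
  then show "radius1 S N (yz_point (\<rho> \<theta>) (h \<theta>)) = \<rho> \<theta> / sin \<theta>"
    by (simp add: radius1_def q_def)
  obtain k where k: "\<And>A. (N has_derivative A) (at q within S) \<Longrightarrow>
       A (yz_point (cos \<theta>) (- sin \<theta>)) = k *\<^sub>R yz_point (cos \<theta>) (- sin \<theta>)"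
    and d: "k \<noteq> 0 \<Longrightarrow> (\<rho> has_real_derivative cos \<theta> / k) (at \<theta>)"
    using shape_operator_profile[OF S I(1,2) \<theta>(1) I(3,4) qS qN] unfolding q_def by blast
  have prd: "profile_dir N q = \<rho> \<theta> *\<^sub>R yz_point (cos \<theta>) (- sin \<theta>)"
    using q(2) by (simp add: profile_dir_def parallel_dir_def cross3_def q_def vec_eq_iff forall_3)
  have "yz_point (cos \<theta>) (- sin \<theta>) \<noteq> 0"
    using sin_zero_abs_cos_one[of \<theta>] by (auto simp: vec_eq_iff forall_3)
  moreover have "A (profile_dir N q) = k *\<^sub>R profile_dir N q"
    if "(N has_derivative A) (at q within S)" for A
    using k[OF that] has_derivative_linear[OF that] by (simp add: prd linear_cmul)
  ultimately have k2: "k2 S N q = k"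
    unfolding k2_def using \<theta>(2) by (intro principal_curvature_along_eqI[OF ex]) (simp_all add: prd)
  then have "k \<noteq> 0" using K by (simp add: gauss_curvature_def)
  with d k2 show "(\<rho> has_real_derivative radius2 S N (yz_point (\<rho> \<theta>) (h \<theta>)) * cos \<theta>) (at \<theta>)"
    by (simp add: radius2_def q_def)
qed

section \<open>The contradiction from a bounded quotient\<close>

theorem theorem3p2:
  fixes S :: "(real^3) set" and N :: "real^3 \<Rightarrow> real^3" and p :: "real^3"
    and I U :: "real set" and \<rho> h r1 r2 :: "real \<Rightarrow> real" and \<theta>0 r0 :: real
  assumes surface: "oriented_C2_surface_of_revolution S N"
    and point: "p \<in> S" "p \<notin> z_axis"
    and umbilic: "umbilic S N p"
    and non_flat: "gauss_curvature S N p \<noteq> 0"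
    and angle: "\<theta>0 = gauss_angle N p"
    and profile: "gauss_angle_profile S N p I \<rho> h"
    and r1: "r1 = (\<lambda>\<theta>. radius1 S N (yz_point (\<rho> \<theta>) (h \<theta>)))"
    and r2: "r2 = (\<lambda>\<theta>. radius2 S N (yz_point (\<rho> \<theta>) (h \<theta>)))"
    and r0: "r0 = r1 \<theta>0"
    and U: "punctured_nbhd U \<theta>0" "U \<subseteq> I"
    and distinct: "\<forall>\<theta>\<in>U. r2 \<theta> \<noteq> r1 \<theta>"
  shows "\<not> bounded ((\<lambda>\<theta>. (r2 \<theta> - r0) / (r1 \<theta> - r0)) ` {\<theta> \<in> U. r1 \<theta> \<noteq> r0})"
proof
  assume "bounded ((\<lambda>\<theta>. (r2 \<theta> - r0) / (r1 \<theta> - r0)) ` {\<theta> \<in> U. r1 \<theta> \<noteq> r0})"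
  then obtain M where M: "\<And>\<theta>. \<theta> \<in> U \<Longrightarrow> r1 \<theta> \<noteq> r0 \<Longrightarrow> \<bar>(r2 \<theta> - r0) / (r1 \<theta> - r0)\<bar> \<le> M"
    unfolding bounded_iff by auto
  have I: "open I" "I \<subseteq> {0<..<pi}" "continuous_on I \<rho>" "\<theta>0 \<in> I"
    using profile angle by (auto simp: gauss_angle_profile_def)
  \<comment> \<open>The profile point at \<open>\<theta>0\<close> is a rotation of \<open>p\<close>,
    and rotations preserve the axis, which \<open>p\<close> avoids.\<close>
  have \<rho>0: "\<rho> \<theta>0 \<noteq> 0"
  proof
    assume 0: "\<rho> \<theta>0 = 0"
    from profile obtain \<phi> where "yz_point (\<rho> \<theta>0) (h \<theta>0) = rot_z \<phi> p"
      unfolding gauss_angle_profile_def angle by blast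
    then have "p = rot_z (- \<phi>) (yz_point 0 (h \<theta>0))" by (simp add: 0)
    then have "p \<in> z_axis" by (simp add: z_axis_def)
    then show False using point by simp
  qed
  have sin_pos: "sin \<theta> > 0" if "\<theta> \<in> I" for \<theta> using I(2) that by (auto intro!: sin_gt_zero)
  have "isCont \<rho> \<theta>0" using I by (simp add: continuous_on_eq_continuous_at)
  then have "\<forall>\<^sub>F t in at \<theta>0. \<rho> t \<noteq> 0"
    using \<rho>0 tendsto_imp_eventually_ne by (auto simp: isCont_def)
  moreover have "isCont cot \<theta>0" using sin_pos[OF I(4)] by (intro isCont_cot) auto
  then have "\<forall>\<^sub>F t in at \<theta>0. dist (cot t) (cot \<theta>0) < 1"
    by (auto simp: isCont_def intro: tendstoD)
  moreover have "\<forall>\<^sub>F t in at \<theta>0. t \<in> U"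
    using U(1) unfolding punctured_nbhd_def eventually_at_topological
    by (metis insertE interior_subset open_interior subsetD)
  ultimately have "\<forall>\<^sub>F t in at \<theta>0. \<rho> t \<noteq> 0 \<and> dist (cot t) (cot \<theta>0) < 1 \<and> t \<in> U"
    by eventually_elim auto
  \<comment> \<open>An interval to the right of \<open>\<theta>0\<close> suffices for the Gronwall
    estimate; the bound on \<open>cot\<close> comes from continuity with tolerance 1.\<close>
  then obtain \<delta> where \<delta>: "\<delta> > 0"
    "\<And>t. \<theta>0 < t \<Longrightarrow> t < \<theta>0 + \<delta> \<Longrightarrow> \<rho> t \<noteq> 0 \<and> \<bar>cot t\<bar> \<le> \<bar>cot \<theta>0\<bar> + 1 \<and> t \<in> U"
    unfolding eventually_at by (force simp: dist_real_def)
  \<comment> \<open>\<open>u\<close> is \<open>r1 - r0\<close> in terms of \<open>\<rho>\<close>, so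
    that continuity at \<open>\<theta>0\<close> and the derivative \<open>g\<close> come from
    \<open>\<rho>\<close>.\<close>
  define u where "u t = \<rho> t / sin t - r0" for t
  define g where "g t = (r2 t - r1 t) * cot t" for t
  have r1_eq: "r1 t = \<rho> t / sin t" if "t \<in> I" "\<rho> t \<noteq> 0" for t
    using gauss_angle_profile_radii(1)[OF surface profile that] by (simp add: r1)
  have near: "t \<in> U" "t \<in> I" "\<rho> t \<noteq> 0" "\<bar>cot t\<bar> \<le> \<bar>cot \<theta>0\<bar> + 1" "sin t > 0" "r1 t - r0 = u t"
    if "\<theta>0 < t" "t < \<theta>0 + \<delta>" for t
    using \<delta>(2)[OF that] U(2) r1_eq[of t] sin_pos[of t] by (auto simp: u_def)
  have der: "(u has_real_derivative g t) (at t)" if t: "\<theta>0 < t" "t < \<theta>0 + \<delta>" for t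
  proof -
    note n = near[OF t]
    have "(\<rho> has_real_derivative r2 t * cos t) (at t)"
      using gauss_angle_profile_radii(2)[OF surface profile n(2,3)] by (simp add: r2)
    then have "(u has_real_derivative (r2 t * cos t * sin t - \<rho> t * cos t) / (sin t * sin t)) (at t)"
      unfolding u_def using n(5) by (auto intro!: derivative_eq_intros)
    moreover have "(r2 t * cos t * sin t - \<rho> t * cos t) / (sin t * sin t) = g t"
      using n(5) r1_eq[OF n(2,3)] by (simp add: g_def cot_def field_simps)
    ultimately show ?thesis by simp
  qed
  have u0: "u t = 0" if t: "\<theta>0 < t" "t < \<theta>0 + \<delta>" for t
  proof (rule gronwall_zero[OF _ _ der _ t])
    have "{\<theta>0..<\<theta>0 + \<delta>} \<subseteq> I" using near(2) I(4) by (force simp: less_le)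
    then show "continuous_on {\<theta>0..<\<theta>0 + \<delta>} u"
      unfolding u_def using less_imp_neq[OF sin_pos]
      by (intro continuous_intros continuous_on_subset[OF I(3)]) (blast, metis subsetD)
    show "u \<theta>0 = 0" using r1_eq[OF I(4) \<rho>0] by (simp add: u_def r0)
    fix s assume s: "\<theta>0 < s" "s < \<theta>0 + \<delta>" and "u s \<noteq> 0"
    note n = near[OF s]
    \<comment> \<open>Since \<open>r2 - r1 = (r2 - r0) - u\<close>, the bound \<open>M\<close>
      becomes \<open>M + 1\<close>; the factor \<open>cot\<close> supplies the rest of the Gronwall
      constant.\<close>
    have "\<bar>r2 s - r0\<bar> \<le> M * \<bar>u s\<bar>"
      using M[OF n(1)] n(6) \<open>u s \<noteq> 0\<close> by (auto simp: abs_divide divide_le_eq)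
    then have "\<bar>r2 s - r1 s\<bar> \<le> (M + 1) * \<bar>u s\<bar>"
      using n(6) by (simp add: algebra_simps)
    then have "\<bar>g s\<bar> \<le> ((M + 1) * \<bar>u s\<bar>) * (\<bar>cot \<theta>0\<bar> + 1)"
      unfolding g_def abs_mult using n(4) by (intro mult_mono) auto
    then show "\<bar>g s\<bar> \<le> ((M + 1) * (\<bar>cot \<theta>0\<bar> + 1)) * \<bar>u s\<bar>" by (simp add: ac_simps)
  qed
  \<comment> \<open>As \<open>u\<close> vanishes, so does \<open>(r2 - r1) cot\<close>, and distinct
    radii leave only the factor \<open>cot\<close>.\<close>
  have cos0: "cos t = 0" if t: "\<theta>0 < t" "t < \<theta>0 + \<delta>" for t
  proof -
    have "(u has_real_derivative 0) (at t)"
      by (rule has_field_derivative_transform_within_open[of "\<lambda>_. 0" _ _ "{\<theta>0<..<\<theta>0 + \<delta>}"])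
        (use t u0 in auto)
    then have "g t = 0" using DERIV_unique[OF der[OF t]] by simp
    then show ?thesis using distinct near[OF t] by (auto simp: g_def cot_def)
  qed
  \<comment> \<open>Cosine may vanish at the single angle \<open>pi / 2\<close>, so two different
    sample points are taken and injectivity on \<open>[0, pi]\<close> is violated.\<close>
  have "cos (\<theta>0 + \<delta> / 2) = 0" "cos (\<theta>0 + \<delta> / 3) = 0"
    using cos0 \<delta>(1) by auto
  moreover have "\<theta>0 + \<delta> / 2 \<in> I" "\<theta>0 + \<delta> / 3 \<in> I" using near(2) \<delta>(1) by auto
  then have "0 < \<theta>0 + \<delta> / 3" "\<theta>0 + \<delta> / 2 < pi" using I(2) by auto
  ultimately show False
    using cos_inj_pi[of "\<theta>0 + \<delta> / 3" "\<theta>0 + \<delta> / 2"] \<delta>(1) by auto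
qed

end
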